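(* Let $N$ and $H$ be finite groups, $\varphi:H\to\mathrm{Aut}(N)$ a homomorphism, and $G=N\rtimes_\varphi H$. Let $D>0$ and suppose $G$ is $D$-quasirandom on $N$. For $g=(z,h)\in G$ write $\dot g=h$. For an integer $k\ge2$ and nonempty subsets $X_1,\ldots,X_k\subseteq G$, let \[ \dot{\mathcal{N}}_k=\#\{(x_1,\ldots,x_k,y_1,\ldots,y_k)\in (X_1\times\cdots\times X_k)^2:\ \dot{x_1}\cdots\dot{x_k}=\dot{y_1}\cdots\dot{y_k}\}. \] Then \[ |X_1X_2\cdots X_k|\ge \frac12\min\left\{\frac{|N|}{\dot{\mathcal{N}}_k}|X_1|^2|X_2|^2\cdots|X_k|^2,\ \frac{D^{k-1}}{|G|^{k-1}}|X_1||X_2|\cdots|X_k|\right\}. \]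
   Context: $G=N\rtimes_\varphi H$ is $\{(z,h):z\in N,h\in H\}$ with $(z_1,h_1)(z_2,h_2)=(z_1\varphi(h_1)(z_2),h_1h_2)$. A complex representation $\rho$ of $G$ is of type II if $\rho((z,1_H))$ is not the identity for some $z\in N$; $G$ is $D$-quasirandom on $N$ if every type II complex representation of $G$ has degree at least $D$. $X_1X_2\cdots X_k=\{x_1x_2\cdots x_k: x_i\in X_i\}$. *)

theory Defs
  imports
    Complex_Main
    "HOL-Algebra.Group"
    "HOL-Algebra.Bij"
    "Jordan_Normal_Form.Matrix"
begin

definition semidirect_product ::
  "('a, 'm) monoid_scheme \<Rightarrow> ('b, 'n) monoid_scheme \<Rightarrow> ('b \<Rightarrow> 'a \<Rightarrow> 'a) \<Rightarrow> ('a \<times> 'b) monoid"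
  where "semidirect_product N H \<phi> =
    \<lparr>carrier = carrier N \<times> carrier H,
     Group.monoid.mult = (\<lambda>(z\<^sub>1, h\<^sub>1) (z\<^sub>2, h\<^sub>2). (z\<^sub>1 \<otimes>\<^bsub>N\<^esub> \<phi> h\<^sub>1 z\<^sub>2, h\<^sub>1 \<otimes>\<^bsub>H\<^esub> h\<^sub>2)),
     one = (\<one>\<^bsub>N\<^esub>, \<one>\<^bsub>H\<^esub>)\<rparr>"

definition complex_GL :: "nat \<Rightarrow> complex mat monoid"
  where "complex_GL n = units_of (ring_mat TYPE(complex) n ())"

definition complex_representation ::
  "('g, 'm) monoid_scheme \<Rightarrow> nat \<Rightarrow> ('g \<Rightarrow> complex mat) \<Rightarrow> bool"
  where "complex_representation G n \<rho> \<longleftrightarrow> \<rho> \<in> hom G (complex_GL n)"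

definition type_II ::
  "('a, 'm) monoid_scheme \<Rightarrow> ('b, 'n) monoid_scheme \<Rightarrow> nat \<Rightarrow> ('a \<times> 'b \<Rightarrow> complex mat) \<Rightarrow> bool"
  where "type_II N H n \<rho> \<longleftrightarrow> (\<exists>z\<in>carrier N. \<rho> (z, \<one>\<^bsub>H\<^esub>) \<noteq> 1\<^sub>m n)"

definition quasirandom_on_normal ::
  "('a, 'm) monoid_scheme \<Rightarrow> ('b, 'n) monoid_scheme \<Rightarrow> ('b \<Rightarrow> 'a \<Rightarrow> 'a) \<Rightarrow> real \<Rightarrow> bool"
  where "quasirandom_on_normal N H \<phi> D \<longleftrightarrow>
    (\<forall>n \<rho>. complex_representation (semidirect_product N H \<phi>) n \<rho> \<longrightarrow> type_II N H n \<rho>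
        \<longrightarrow> D \<le> real n)"

definition ordered_prod :: "('g, 'm) monoid_scheme \<Rightarrow> 'g list \<Rightarrow> 'g"
  where "ordered_prod G xs = foldr (\<otimes>\<^bsub>G\<^esub>) xs \<one>\<^bsub>G\<^esub>"

text \<open>A family of sets is given as a list; \<^term>\<open>listset Xs\<close> is its Cartesian product,
  with tuples represented as lists.\<close>

definition product_set :: "('g, 'm) monoid_scheme \<Rightarrow> 'g set list \<Rightarrow> 'g set"
  where "product_set G Xs = ordered_prod G ` listset Xs"

definition dot_count :: "('b, 'n) monoid_scheme \<Rightarrow> ('a \<times> 'b) set list \<Rightarrow> nat"
  where "dot_count H Xs =
    card {(xs, ys). xs \<in> listset Xs \<and> ys \<in> listset Xs \<and>
      ordered_prod H (map snd xs) = ordered_prod H (map snd ys)}"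

end

theory Submission
  imports Defs "HOL-Algebra.Coset" "HOL-Analysis.Function_Topology" "HOL-Analysis.Convex"
begin

text \<open>
  Let \<open>r(g)\<close> be the number of ways to write \<open>g\<close> as \<open>x\<^sub>1 \<cdots> x\<^sub>k\<close> with \<open>x\<^sub>i \<in> X\<^sub>i\<close>. By Cauchy--Schwarz the
  product set has at least \<open>(\<Prod>|X\<^sub>i|)\<^sup>2 / \<parallel>r\<parallel>\<^sup>2\<close> elements. Split \<open>r\<close> orthogonally into its average over the
  cosets of \<open>N\<close>, of squared norm exactly the collision count in \<open>H\<close> divided by \<open>|N|\<close>, and a part with zero
  mean on every coset. Since \<open>r\<close> is an iterated convolution of the indicators of the \<open>X\<^sub>i\<close>, the second part
  is controlled by the estimate \<open>\<parallel>1\<^sub>X * u\<parallel>\<^sup>2 \<le> |G|/D |X| \<parallel>u\<parallel>\<^sup>2\<close> for functions \<open>u\<close> with zero coset means.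

  For that estimate, let \<open>l\<close> be the maximum of \<open>\<parallel>1\<^sub>X * u\<parallel>\<^sup>2\<close> over unit vectors with zero coset means. The
  functions attaining \<open>\<parallel>1\<^sub>X * u\<parallel>\<^sup>2 = l \<parallel>u\<parallel>\<^sup>2\<close> form a space invariant under right translations, on which
  \<open>N\<close> acts nontrivially because an \<open>N\<close>-invariant function with zero coset means vanishes. So its
  dimension is at least \<open>D\<close>, while Bessel's inequality bounds dimension times \<open>l\<close> by \<open>|G| |X|\<close>.
\<close>

subsection \<open>Orthonormal systems of real functions on a finite set\<close>

definition ip :: "'g set \<Rightarrow> ('g \<Rightarrow> real) \<Rightarrow> ('g \<Rightarrow> real) \<Rightarrow> real" where
  "ip S u v = (\<Sum>x\<in>S. u x * v x)"

lemma ip_add_left: "ip S (\<lambda>x. u x + v x) w = ip S u w + ip S v w"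
  by (simp add: ip_def algebra_simps sum.distrib)

lemma ip_scale_left: "ip S (\<lambda>x. c * u x) w = c * ip S u w"
  by (simp add: ip_def sum_distrib_left algebra_simps)

lemma ip_commute: "ip S u v = ip S v u"
  by (simp add: ip_def mult.commute)

lemma ip_add_right: "ip S w (\<lambda>x. u x + v x) = ip S w u + ip S w v"
  by (simp add: ip_commute[of S w] ip_add_left)

lemma ip_scale_right: "ip S w (\<lambda>x. c * u x) = c * ip S w u"
  by (simp add: ip_commute[of S w] ip_scale_left)

lemma ip_sum_left: "ip S (\<lambda>x. \<Sum>i\<in>I. f i x) w = (\<Sum>i\<in>I. ip S (f i) w)"
  unfolding ip_def by (simp add: sum_distrib_right) (rule sum.swap)

lemma ip_self_nonneg: "0 \<le> ip S u u"
  by (simp add: ip_def sum_nonneg)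

lemma ip_self_eq_0_iff: "finite S \<Longrightarrow> ip S u u = 0 \<longleftrightarrow> (\<forall>x\<in>S. u x = 0)"
  by (simp add: ip_def sum_nonneg_eq_0_iff)

lemma ip_cong:
  "(\<And>x. x \<in> S \<Longrightarrow> u x = u' x) \<Longrightarrow> (\<And>x. x \<in> S \<Longrightarrow> v x = v' x) \<Longrightarrow> ip S u v = ip S u' v'"
  by (simp add: ip_def)

definition orthonormal :: "'g set \<Rightarrow> nat \<Rightarrow> (nat \<Rightarrow> 'g \<Rightarrow> real) \<Rightarrow> bool" where
  "orthonormal S n b \<longleftrightarrow> (\<forall>i<n. \<forall>j<n. ip S (b i) (b j) = (if i = j then 1 else 0))"

lemma ip_residual:
  assumes "orthonormal S n b" "j < n"
  shows "ip S (\<lambda>x. v x - (\<Sum>i<n. ip S v (b i) * b i x)) (b j) = 0"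
proof -
  have "ip S (\<lambda>x. v x - (\<Sum>i<n. ip S v (b i) * b i x)) (b j)
      = ip S v (b j) - (\<Sum>i<n. ip S v (b i) * ip S (b i) (b j))"
    using ip_add_left[of S v "\<lambda>x. -1 * (\<Sum>i<n. ip S v (b i) * b i x)" "b j"]
    by (simp only: ip_scale_left ip_sum_left) simp
  also have "(\<Sum>i<n. ip S v (b i) * ip S (b i) (b j)) = (\<Sum>i<n. if i = j then ip S v (b i) else 0)"
    using assms by (intro sum.cong) (auto simp: orthonormal_def)
  finally show ?thesis using assms by simp
qed

lemma bessel:
  assumes "orthonormal S n b"
  shows "(\<Sum>i<n. (ip S v (b i))\<^sup>2) \<le> ip S v v"
proof -
  define p where "p = (\<lambda>x. \<Sum>i<n. ip S v (b i) * b i x)"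
  define r where "r = (\<lambda>x. v x - p x)"
  have rb: "ip S r (b j) = 0" if "j < n" for j
    using ip_residual[OF assms that, of v] by (simp add: r_def p_def)
  have pr: "ip S p w = (\<Sum>i<n. ip S v (b i) * ip S (b i) w)" for w
    by (simp add: p_def ip_sum_left ip_scale_left)
  have "ip S p r = 0"
    unfolding pr using rb by (simp add: ip_commute[of S _ r])
  have v: "v = (\<lambda>x. p x + r x)" by (simp add: r_def)
  have "ip S v v = ip S p v + ip S r v"
    by (subst v) (rule ip_add_left)
  also have "ip S r v = ip S r r"
    using \<open>ip S p r = 0\<close> by (subst v) (simp add: ip_add_right ip_commute)
  also have "ip S p v = (\<Sum>i<n. (ip S v (b i))\<^sup>2)"
    unfolding pr by (simp add: power2_eq_square ip_commute[of S _ v])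
  finally show ?thesis using ip_self_nonneg[of S r] by simp
qed

text \<open>Bessel's inequality for the point mass at \<open>x\<close> bounds the sum of the squares
  of \<open>b i x\<close> over \<open>i\<close> by 1; summing over \<open>x\<close> counts the unit
  norms of the \<open>b i\<close> and gives \<open>n\<close>. This caps the length of orthonormal
  systems, so that a longest one exists.\<close>

lemma orthonormal_le_card:
  assumes "finite S" "orthonormal S n b"
  shows "n \<le> card S"
proof -
  have "real n = (\<Sum>i<n. ip S (b i) (b i))"
    using assms by (simp add: orthonormal_def)
  also have "\<dots> = (\<Sum>x\<in>S. \<Sum>i<n. (ip S (\<lambda>y. if y = x then 1 else 0) (b i))\<^sup>2)"
    using assms(1) unfolding ip_def
    by (subst sum.swap) (simp add: if_distrib[of "\<lambda>c. c * _"] power2_eq_square cong: if_cong)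
  also have "\<dots> \<le> (\<Sum>x\<in>S. ip S (\<lambda>y. if y = x then 1 else 0) (\<lambda>y. if y = x then 1 else 0))"
    by (intro sum_mono bessel assms)
  also have "\<dots> = (\<Sum>x\<in>S. 1)"
    using assms(1) unfolding ip_def by (intro sum.cong) (simp_all add: if_distrib[of "\<lambda>c. c * _"] cong: if_cong)
  finally show ?thesis by simp
qed

text \<open>A longest orthonormal system in \<open>W\<close> spans it: a vector with nonzero
  residual would, after normalization, lengthen the system. The expansion is claimed only on
  \<open>S\<close>, because \<open>ip S\<close> cannot see values elsewhere.\<close>

lemma orthonormal_basis_exists:
  fixes W :: "('g \<Rightarrow> real) set"
  assumes fin: "finite S"
    and closed: "\<And>u v c. u \<in> W \<Longrightarrow> v \<in> W \<Longrightarrow> (\<lambda>x. u x + c * v x) \<in> W"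
  obtains n b where "orthonormal S n b" "\<And>i. i < n \<Longrightarrow> b i \<in> W"
    "\<And>v x. v \<in> W \<Longrightarrow> x \<in> S \<Longrightarrow> v x = (\<Sum>i<n. ip S v (b i) * b i x)"
proof -
  define P where "P n \<longleftrightarrow> (\<exists>b. orthonormal S n b \<and> (\<forall>i<n. b i \<in> W))" for n
  have "P 0" by (auto simp: P_def orthonormal_def)
  have bnd: "P n \<Longrightarrow> n \<le> card S" for n
    unfolding P_def using orthonormal_le_card[OF fin] by blast
  define n where "n = (GREATEST n. P n)"
  have "P n" unfolding n_def using \<open>P 0\<close> bnd by (rule GreatestI_nat)
  then obtain b where b: "orthonormal S n b" "\<And>i. i < n \<Longrightarrow> b i \<in> W"
    by (auto simp: P_def)
  have "v x = (\<Sum>i<n. ip S v (b i) * b i x)" if v: "v \<in> W" and x: "x \<in> S" for v x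
  proof -
    define r where "r = (\<lambda>x. v x - (\<Sum>i<n. ip S v (b i) * b i x))"
    \<comment> \<open>\<open>closed\<close> adds one multiple of one vector at a time, so the
      projection is subtracted term by term; \<open>m = n\<close> gives \<open>r\<close>.\<close>
    have "(\<lambda>x. v x - (\<Sum>i<m. ip S v (b i) * b i x)) \<in> W" if "m \<le> n" for m
      using that
    proof (induction m)
      case 0 then show ?case using v by simp
    next
      case (Suc m)
      then have "(\<lambda>x. v x - (\<Sum>i<m. ip S v (b i) * b i x)) \<in> W" by simp
      from closed[OF this b(2)[of m], of "- ip S v (b m)"] Suc.prems
      show ?case by (simp add: algebra_simps)
    qed
    then have "r \<in> W" by (simp add: r_def)
    have rb: "ip S r (b j) = 0" if "j < n" for j
      using ip_residual[OF b(1) that] by (simp add: r_def)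
    have "ip S r r = 0"
    proof (rule ccontr)
      assume "ip S r r \<noteq> 0"
      then have pos: "ip S r r > 0" using ip_self_nonneg[of S r] by linarith
      define s where "s = 1 / sqrt (ip S r r)"
      define e where "e = (\<lambda>x. s * r x)"
      have "e \<in> W"
        \<comment> \<open>Scaling is obtained from \<open>closed\<close> as r + (s - 1) r = s
          r.\<close>
        using closed[OF \<open>r \<in> W\<close> \<open>r \<in> W\<close>, of "s - 1"] by (simp add: e_def algebra_simps)
      have "ip S e e = s * s * ip S r r"
        by (simp add: e_def ip_scale_left ip_scale_right)
      also have "\<dots> = 1" using pos by (simp add: s_def)
      finally have "ip S e e = 1" .
      moreover have "ip S e (b j) = 0" if "j < n" for j
        using rb[OF that] by (simp add: e_def ip_scale_left)
      moreover have "ip S (b j) e = 0" if "j < n" for j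
        using rb[OF that] by (simp add: e_def ip_scale_right ip_commute)
      ultimately have "orthonormal S (Suc n) (b(n := e))"
        using b(1) by (auto simp: orthonormal_def less_Suc_eq)
      moreover have "\<forall>i<Suc n. (b(n := e)) i \<in> W"
        using b(2) \<open>e \<in> W\<close> by (auto simp: less_Suc_eq)
      ultimately have "P (Suc n)" unfolding P_def by blast
      then have "Suc n \<le> n" unfolding n_def by (rule Greatest_le_nat) (rule bnd)
      then show False by simp
    qed
    with fin x show ?thesis by (simp add: ip_self_eq_0_iff r_def)
  qed
  with b show ?thesis by (rule that)
qed

text \<open>The values off \<open>S\<close> are pinned to 0, since \<open>ip S\<close> would leave
  them free. The sphere is then a closed subset of a product of intervals [-1, 1] and singletons
  {0}, which is compact by Tychonoff's theorem.\<close>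

lemma compact_zero_extended_unit_sphere:
  fixes S :: "'g set"
  assumes "finite S"
  shows "compact {u :: 'g \<Rightarrow> real. (\<forall>x. x \<notin> S \<longrightarrow> u x = 0) \<and> ip S u u = 1}"
proof -
  define B where "B = (\<Pi>\<^sub>E x\<in>UNIV. if x \<in> S then {-1..1::real} else {0})"
  have "compactin (product_topology (\<lambda>_. euclidean) UNIV) B"
    unfolding B_def by (subst compactin_PiE) (auto simp: compactin_euclidean_iff)
  then have "compact B" by (simp add: euclidean_product_topology flip: compactin_euclidean_iff)
  moreover have "closed {u :: 'g \<Rightarrow> real. ip S u u = 1}"
    unfolding ip_def by (intro closed_Collect_eq continuous_intros) simp_all
  ultimately have "compact (B \<inter> {u. ip S u u = 1})" by (rule compact_Int_closed)
  moreover have "{u :: 'g \<Rightarrow> real. (\<forall>x. x \<notin> S \<longrightarrow> u x = 0) \<and> ip S u u = 1} = B \<inter> {u. ip S u u = 1}"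
  proof -
    have "u x \<in> {-1..1}" if "ip S u u = 1" "x \<in> S" for u :: "'g \<Rightarrow> real" and x
    proof -
      have "u x * u x \<le> ip S u u"
        unfolding ip_def using assms that(2) by (intro member_le_sum) auto
      then have "\<bar>u x\<bar> \<le> 1" using that(1) by (simp add: abs_square_le_1 flip: power2_eq_square)
      then show ?thesis by auto
    qed
    then show ?thesis by (auto simp: B_def PiE_iff split: if_splits)
  qed
  ultimately show ?thesis by simp
qed

subsection \<open>Convolution on a finite group with a normal subgroup\<close>

text \<open>This is the convolution 1_X * u. It acts from the left, and hence commutes with right
  translations.\<close>

definition conv :: "('g, 'm) monoid_scheme \<Rightarrow> 'g set \<Rightarrow> ('g \<Rightarrow> real) \<Rightarrow> 'g \<Rightarrow> real" where
  "conv G X u = (\<lambda>x. \<Sum>y\<in>X. u (inv\<^bsub>G\<^esub> y \<otimes>\<^bsub>G\<^esub> x))"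

definition mean_zero :: "('g, 'm) monoid_scheme \<Rightarrow> 'g set \<Rightarrow> ('g \<Rightarrow> real) \<Rightarrow> bool" where
  "mean_zero G K u \<longleftrightarrow> (\<forall>x\<in>carrier G. (\<Sum>z\<in>K. u (x \<otimes>\<^bsub>G\<^esub> z)) = 0)"

text \<open>Quasirandomness stated for a subgroup \<open>K\<close> of an arbitrary group, so that
  the convolution estimate can be proved without coordinates; later \<open>K\<close> is the copy of
  \<open>N\<close> in the semidirect product.\<close>

definition nontrivial_degree_bound :: "('g, 'm) monoid_scheme \<Rightarrow> 'g set \<Rightarrow> real \<Rightarrow> bool" where
  "nontrivial_degree_bound G K D \<longleftrightarrow>
    (\<forall>n \<rho>. complex_representation G n \<rho> \<longrightarrow> (\<exists>z\<in>K. \<rho> z \<noteq> 1\<^sub>m n) \<longrightarrow> D \<le> real n)"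

locale finite_group_with_normal = normal K G for K and G (structure) +
  assumes finite_carrier: "finite (carrier G)"
begin

lemma finite_K: "finite K"
  using finite_carrier subset finite_subset by blast

lemma card_K_pos: "card K > 0"
  using finite_K subgroup.one_closed[OF subgroup_axioms] by (metis card_gt_0_iff empty_iff)

lemma sum_right_translate:
  assumes "a \<in> carrier G"
  shows "(\<Sum>x\<in>carrier G. f (x \<otimes> a)) = (\<Sum>x\<in>carrier G. f x)"
  using assms by (intro sum.reindex_bij_witness[of _ "\<lambda>x. x \<otimes> inv a" "\<lambda>x. x \<otimes> a"]) (auto simp: m_assoc)

lemma ip_right_translate:
  assumes "a \<in> carrier G"
  shows "ip (carrier G) (\<lambda>x. u (x \<otimes> a)) (\<lambda>x. v (x \<otimes> a)) = ip (carrier G) u v"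
  unfolding ip_def using sum_right_translate[OF assms, of "\<lambda>x. u x * v x"] .

lemma conv_lincomb: "conv G X (\<lambda>x. u x + c * v x) = (\<lambda>x. conv G X u x + c * conv G X v x)"
  by (simp add: conv_def sum.distrib sum_distrib_left)

lemma conv_scale: "conv G X (\<lambda>x. c * v x) = (\<lambda>x. c * conv G X v x)"
  by (simp add: conv_def sum_distrib_left)

lemma conv_cong:
  assumes "X \<subseteq> carrier G" "\<And>x. x \<in> carrier G \<Longrightarrow> u x = v x" "x \<in> carrier G"
  shows "conv G X u x = conv G X v x"
  unfolding conv_def using assms by (intro sum.cong) auto

lemma conv_right_translate:
  assumes "X \<subseteq> carrier G" "a \<in> carrier G" "x \<in> carrier G"
  shows "conv G X (\<lambda>x. u (x \<otimes> a)) x = conv G X u (x \<otimes> a)"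
  unfolding conv_def using assms by (intro sum.cong) (auto simp: m_assoc subset_iff)

lemma mean_zero_lincomb:
  "mean_zero G K u \<Longrightarrow> mean_zero G K v \<Longrightarrow> mean_zero G K (\<lambda>x. u x + c * v x)"
  by (simp add: mean_zero_def sum.distrib flip: sum_distrib_left)

lemma mean_zero_scale: "mean_zero G K v \<Longrightarrow> mean_zero G K (\<lambda>x. c * v x)"
  by (simp add: mean_zero_def flip: sum_distrib_left)

lemma mean_zero_cong:
  "(\<And>x. x \<in> carrier G \<Longrightarrow> u x = v x) \<Longrightarrow> mean_zero G K u \<longleftrightarrow> mean_zero G K v"
  unfolding mean_zero_def using subset by (intro ball_cong) (auto intro!: arg_cong[of _ _ "\<lambda>s. s = 0"] sum.cong)

text \<open>Normality enters here: x z a = (x a)(a^-1 z a), and conjugation by \<open>a\<close>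
  permutes \<open>K\<close>, so the translate has the same sums over cosets in another
  order.\<close>

lemma mean_zero_right_translate:
  assumes "a \<in> carrier G" "mean_zero G K u"
  shows "mean_zero G K (\<lambda>x. u (x \<otimes> a))"
  unfolding mean_zero_def
proof
  fix x assume x: "x \<in> carrier G"
  have "(\<Sum>z\<in>K. u (x \<otimes> z \<otimes> a)) = (\<Sum>z\<in>K. u (x \<otimes> a \<otimes> z))"
  proof (rule sum.reindex_bij_witness[of _ "\<lambda>z. a \<otimes> z \<otimes> inv a" "\<lambda>z. inv a \<otimes> z \<otimes> a"])
    fix z assume z: "z \<in> K"
    have cancel: "a \<otimes> (inv a \<otimes> y) = y" "inv a \<otimes> (a \<otimes> y) = y" if "y \<in> carrier G" for y
      using that assms(1) by (simp_all flip: m_assoc)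
    show "inv a \<otimes> z \<otimes> a \<in> K" "a \<otimes> z \<otimes> inv a \<in> K"
      using z assms(1) by (simp_all add: inv_op_closed1 inv_op_closed2)
    have z': "z \<in> carrier G" using z by (rule mem_carrier)
    show "a \<otimes> (inv a \<otimes> z \<otimes> a) \<otimes> inv a = z" "inv a \<otimes> (a \<otimes> z \<otimes> inv a) \<otimes> a = z"
      "u (x \<otimes> a \<otimes> (inv a \<otimes> z \<otimes> a)) = u (x \<otimes> z \<otimes> a)"
      using z' assms(1) x by (simp_all add: m_assoc cancel)
  qed
  also have "\<dots> = 0" using assms x by (simp add: mean_zero_def)
  finally show "(\<Sum>z\<in>K. u (x \<otimes> z \<otimes> a)) = 0" .
qed

section \<open>The convolution estimate on functions with zero coset means\<close>

lemma sum_ip_conv_le: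
  assumes b: "orthonormal (carrier G) n b" and X: "X \<subseteq> carrier G"
  shows "(\<Sum>i<n. ip (carrier G) (conv G X (b i)) (conv G X (b i))) \<le> card (carrier G) * card X"
proof -
  \<comment> \<open>\<open>k x\<close> is row \<open>x\<close> of the matrix of the convolution
    operator, the indicator of X^-1 x. Bessel for each row, summed over all rows, bounds the total
    by the squared Hilbert-Schmidt norm, |G| |X|.\<close>
  define k where "k x = (\<lambda>w. if w \<in> (\<lambda>y. inv y \<otimes> x) ` X then 1 else 0 :: real)" for x
  have inj: "inj_on (\<lambda>y. inv y \<otimes> x) X" if "x \<in> carrier G" for x
    using X that by (auto intro!: inj_onI simp: subset_iff)
  have sub: "(\<lambda>y. inv y \<otimes> x) ` X \<subseteq> carrier G" if "x \<in> carrier G" for x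
    using X that by auto
  have kip: "ip (carrier G) (k x) v = conv G X v x" if "x \<in> carrier G" for x v
  proof -
    have "ip (carrier G) (k x) v = (\<Sum>w\<in>carrier G. if w \<in> (\<lambda>y. inv y \<otimes> x) ` X then v w else 0)"
      unfolding ip_def k_def by (intro sum.cong) auto
    also have "\<dots> = (\<Sum>w\<in>(\<lambda>y. inv y \<otimes> x) ` X. v w)"
      using sub[OF that] finite_carrier by (simp add: sum.inter_restrict[symmetric] Int_absorb1)
    also have "\<dots> = conv G X v x"
      unfolding conv_def using inj[OF that] by (simp add: sum.reindex)
    finally show ?thesis .
  qed
  have kk: "ip (carrier G) (k x) (k x) = card X" if "x \<in> carrier G" for x
    using that by (simp add: kip) (simp add: conv_def k_def)
  have "(\<Sum>i<n. ip (carrier G) (conv G X (b i)) (conv G X (b i)))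
      = (\<Sum>x\<in>carrier G. \<Sum>i<n. (conv G X (b i) x)\<^sup>2)"
    unfolding ip_def power2_eq_square by (rule sum.swap)
  also have "\<dots> = (\<Sum>x\<in>carrier G. \<Sum>i<n. (ip (carrier G) (k x) (b i))\<^sup>2)"
    by (simp add: kip)
  also have "\<dots> \<le> (\<Sum>x\<in>carrier G. ip (carrier G) (k x) (k x))"
    by (intro sum_mono bessel b)
  also have "\<dots> = card (carrier G) * card X" by (simp add: kk)
  finally show ?thesis .
qed

text \<open>A continuous function on the compact set of unit vectors with zero coset means attains
  its maximum \<open>l\<close>; homogeneity extends the bound to all lengths. The function
  \<open>u\<close> guarantees that this set is nonempty.\<close>

lemma conv_maximum:
  assumes X: "X \<subseteq> carrier G" and u: "mean_zero G K u" "ip (carrier G) u u \<noteq> 0"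
  obtains w l where "mean_zero G K w" "ip (carrier G) w w = 1"
    "ip (carrier G) (conv G X w) (conv G X w) = l"
    "\<And>v. mean_zero G K v \<Longrightarrow> ip (carrier G) (conv G X v) (conv G X v) \<le> l * ip (carrier G) v v"
proof -
  let ?S = "carrier G"
  let ?Q = "\<lambda>v. ip ?S (conv G X v) (conv G X v)"
  define U where "U = {u. (\<forall>x. x \<notin> ?S \<longrightarrow> u x = 0) \<and> ip ?S u u = 1} \<inter> {u. mean_zero G K u}"
  have "closed {u. mean_zero G K u}"
    unfolding mean_zero_def Ball_def
    by (intro closed_Collect_all closed_Collect_imp closed_Collect_eq continuous_intros) simp_all
  then have cpt: "compact U"
    unfolding U_def by (intro compact_Int_closed compact_zero_extended_unit_sphere finite_carrier)
  have cont: "continuous_on U ?Q"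
    unfolding ip_def conv_def by (intro continuous_intros continuous_on_subset[OF continuous_on_product_coordinates]) simp_all
  have normalize: "\<exists>w\<in>U. ?Q v = ?Q w * ip ?S v v" if v: "mean_zero G K v" "ip ?S v v \<noteq> 0" for v
  proof -
    have pos: "ip ?S v v > 0" using ip_self_nonneg[of ?S v] v by linarith
    define s where "s = 1 / sqrt (ip ?S v v)"
    define w where "w = (\<lambda>x. if x \<in> ?S then s * v x else 0)"
    have ss: "s * s * ip ?S v v = 1" using pos by (simp add: s_def)
    have "ip ?S w w = ip ?S (\<lambda>x. s * v x) (\<lambda>x. s * v x)"
      by (intro ip_cong) (auto simp: w_def)
    also have "\<dots> = 1" using ss by (simp add: ip_scale_left ip_scale_right mult.assoc)
    finally have "ip ?S w w = 1" .
    moreover have "mean_zero G K w"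
      using mean_zero_scale[OF v(1), of s] by (subst mean_zero_cong[of w "\<lambda>x. s * v x"]) (auto simp: w_def)
    ultimately have "w \<in> U" by (auto simp: U_def w_def)
    moreover have "?Q w = s * s * ?Q v"
    proof -
      have "?Q w = ip ?S (conv G X (\<lambda>x. s * v x)) (conv G X (\<lambda>x. s * v x))"
        by (intro ip_cong conv_cong X) (auto simp: w_def)
      then show ?thesis by (simp add: conv_scale ip_scale_left ip_scale_right mult.assoc)
    qed
    then have "?Q w * ip ?S v v = ?Q v" using ss by (simp add: algebra_simps)
    ultimately show ?thesis by metis
  qed
  have "U \<noteq> {}" using normalize[OF u] by auto
  then obtain w where w: "w \<in> U" "\<And>v. v \<in> U \<Longrightarrow> ?Q v \<le> ?Q w"
    using continuous_attains_sup[OF cpt _ cont] by blast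
  have "?Q v \<le> ?Q w * ip ?S v v" if v: "mean_zero G K v" for v
  proof (cases "ip ?S v v = 0")
    case True
    then have "?Q v = ip ?S (conv G X (\<lambda>x. 0)) (conv G X (\<lambda>x. 0))"
      using finite_carrier by (intro ip_cong conv_cong X) (auto simp: ip_self_eq_0_iff)
    then show ?thesis using True by (simp add: conv_def ip_def)
  next
    case False
    then obtain w' where "w' \<in> U" "?Q v = ?Q w' * ip ?S v v" using normalize[OF v] by blast
    then show ?thesis using w(2)[of w'] ip_self_nonneg[of ?S v] by (simp add: mult_right_mono)
  qed
  with w(1) show ?thesis by (intro that[of w "?Q w"]) (auto simp: U_def)
qed

text \<open>The operators (R_a f)(x) = f(x a) satisfy R_a R_c = R_(a c), and \<open>expand\<close>
  says that they preserve the span of \<open>b\<close>. Column \<open>j\<close> of the matrix holds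
  the coordinates of R_a (b j); the real entries are only embedded into the complex numbers.\<close>

lemma translation_representation:
  assumes b: "orthonormal (carrier G) n b"
    and expand: "\<And>a j x. a \<in> carrier G \<Longrightarrow> j < n \<Longrightarrow> x \<in> carrier G \<Longrightarrow>
      b j (x \<otimes> a) = (\<Sum>i<n. ip (carrier G) (\<lambda>x. b j (x \<otimes> a)) (b i) * b i x)"
  shows "complex_representation G n
    (\<lambda>a. mat n n (\<lambda>(i, j). complex_of_real (ip (carrier G) (\<lambda>x. b j (x \<otimes> a)) (b i))))"
proof -
  define m where "m a i j = ip (carrier G) (\<lambda>x. b j (x \<otimes> a)) (b i)" for a i j
  define \<rho> where "\<rho> a = mat n n (\<lambda>(i, j). complex_of_real (m a i j))" for a
  have m_mult: "m (a \<otimes> c) i j = (\<Sum>k<n. m a i k * m c k j)"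
    if "a \<in> carrier G" "c \<in> carrier G" "i < n" "j < n" for a c i j
  proof -
    have "m (a \<otimes> c) i j = ip (carrier G) (\<lambda>x. \<Sum>k<n. m c k j * b k (x \<otimes> a)) (b i)"
      unfolding m_def[of "a \<otimes> c"]
    proof (rule ip_cong)
      fix x assume "x \<in> carrier G"
      then show "b j (x \<otimes> (a \<otimes> c)) = (\<Sum>k<n. m c k j * b k (x \<otimes> a))"
        using expand[of c j "x \<otimes> a"] that by (simp add: m_def m_assoc)
    qed simp
    also have "\<dots> = (\<Sum>k<n. m c k j * m a i k)"
      by (simp add: ip_sum_left ip_scale_left m_def)
    finally show ?thesis by (simp add: mult.commute)
  qed
  have \<rho>_mult: "\<rho> (a \<otimes> c) = \<rho> a * \<rho> c" if "a \<in> carrier G" "c \<in> carrier G" for a c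
    using m_mult[OF that]
    by (intro eq_matI) (auto simp: \<rho>_def scalar_prod_def lessThan_atLeast0)
  have \<rho>_one: "\<rho> \<one> = 1\<^sub>m n"
  proof (rule eq_matI)
    fix i j assume "i < dim_row (1\<^sub>m n :: complex mat)" "j < dim_col (1\<^sub>m n :: complex mat)"
    then have ij: "i < n" "j < n" by auto
    have "m \<one> i j = ip (carrier G) (b j) (b i)"
      unfolding m_def by (intro ip_cong) auto
    then show "\<rho> \<one> $$ (i, j) = 1\<^sub>m n $$ (i, j)"
      using b ij by (auto simp: \<rho>_def orthonormal_def)
  qed (auto simp: \<rho>_def)
  have \<rho>_carrier: "\<rho> a \<in> carrier_mat n n" for a by (simp add: \<rho>_def)
  have "\<rho> \<in> hom G (complex_GL n)"
  proof (rule homI)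
    fix a assume a: "a \<in> carrier G"
    have "\<rho> a * \<rho> (inv a) = 1\<^sub>m n" "\<rho> (inv a) * \<rho> a = 1\<^sub>m n"
      using \<rho>_mult[of a "inv a"] \<rho>_mult[of "inv a" a] a \<rho>_one by auto
    then show "\<rho> a \<in> carrier (complex_GL n)"
      using \<rho>_carrier by (auto simp: complex_GL_def units_of_def Units_def ring_mat_simps)
  next
    fix a c assume "a \<in> carrier G" "c \<in> carrier G"
    then show "\<rho> (a \<otimes> c) = \<rho> a \<otimes>\<^bsub>complex_GL n\<^esub> \<rho> c"
      by (simp add: \<rho>_mult complex_GL_def units_of_def ring_mat_simps)
  qed
  then show ?thesis unfolding complex_representation_def \<rho>_def m_def .
qed

lemma conv_norm_le:
  assumes D: "D > 0" and qr: "nontrivial_degree_bound G K D"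
    and X: "X \<subseteq> carrier G" and u: "mean_zero G K u"
  shows "ip (carrier G) (conv G X u) (conv G X u)
    \<le> card (carrier G) / D * card X * ip (carrier G) u u"
proof (cases "ip (carrier G) u u = 0")
  \<comment> \<open>\<open>conv_maximum\<close> needs a function of nonzero norm, so functions
    vanishing on the group are treated separately.\<close>
  case True
  let ?S = "carrier G"
  have "ip ?S (conv G X u) (conv G X u) = ip ?S (conv G X (\<lambda>x. 0)) (conv G X (\<lambda>x. 0))"
    using finite_carrier True by (intro ip_cong conv_cong X) (auto simp: ip_self_eq_0_iff)
  then show ?thesis using True by (simp add: conv_def ip_def)
next
  case False
  let ?S = "carrier G"
  let ?Q = "\<lambda>v. ip ?S (conv G X v) (conv G X v)"
  obtain w l where w: "mean_zero G K w" "ip ?S w w = 1" "?Q w = l"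
    and max: "\<And>v. mean_zero G K v \<Longrightarrow> ?Q v \<le> l * ip ?S v v"
    by (rule conv_maximum[OF X u False]) (rule that)
  \<comment> \<open>The defect from the maximum: nonnegative on functions with zero coset means, and
    zero exactly for those attaining the ratio \<open>l\<close>.\<close>
  define q where "q v = l * ip ?S v v - ?Q v" for v
  define W where "W = {v. mean_zero G K v \<and> q v = 0}"
  have "w \<in> W" using w by (simp add: W_def q_def)
  have q_nonneg: "mean_zero G K v \<Longrightarrow> q v \<ge> 0" for v using max by (simp add: q_def)
  \<comment> \<open>The zeros of the nonnegative quadratic form \<open>q\<close> form a subspace by the parallelogram law, so no
    spectral theorem is needed to know that the top eigenspace is one.\<close>
  have parallelogram: "q (\<lambda>x. u x + c * v x) + q (\<lambda>x. u x + (-c) * v x) = 2 * q u + 2 * c\<^sup>2 * q v" for u v c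
    unfolding q_def conv_lincomb ip_add_left ip_add_right ip_scale_left ip_scale_right
    by (simp add: ip_commute algebra_simps power2_eq_square)
  have closed: "(\<lambda>x. u x + c * v x) \<in> W" if "u \<in> W" "v \<in> W" for u v c
  proof -
    have mz: "mean_zero G K (\<lambda>x. u x + c * v x)" for c
      using that by (intro mean_zero_lincomb) (auto simp: W_def)
    have "q (\<lambda>x. u x + c * v x) = 0"
      using parallelogram[of u c v] q_nonneg[OF mz[of c]] q_nonneg[OF mz[of "-c"]] that
      by (simp add: W_def)
    with mz show ?thesis by (simp add: W_def)
  qed
  have translate: "(\<lambda>x. v (x \<otimes> a)) \<in> W" if "v \<in> W" "a \<in> carrier G" for v a
  proof -
    have "?Q (\<lambda>x. v (x \<otimes> a)) = ip ?S (\<lambda>x. conv G X v (x \<otimes> a)) (\<lambda>x. conv G X v (x \<otimes> a))"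
      using that X by (intro ip_cong conv_right_translate) auto
    then have "q (\<lambda>x. v (x \<otimes> a)) = q v"
      using that by (simp add: q_def ip_right_translate)
    then show ?thesis using that mean_zero_right_translate by (simp add: W_def)
  qed
  obtain n b where b: "orthonormal ?S n b" "\<And>i. i < n \<Longrightarrow> b i \<in> W"
    and expand: "\<And>v x. v \<in> W \<Longrightarrow> x \<in> ?S \<Longrightarrow> v x = (\<Sum>i<n. ip ?S v (b i) * b i x)"
    by (rule orthonormal_basis_exists[OF finite_carrier]) (erule (1) closed, rule that)
  have "n > 0"
  proof (rule ccontr)
    assume "\<not> n > 0"
    then have "w x = 0" if "x \<in> ?S" for x using expand[OF \<open>w \<in> W\<close> that] by simp
    then show False using w(2) by (simp add: ip_def)
  qed
  define \<rho> where "\<rho> a = mat n n (\<lambda>(i, j). complex_of_real (ip ?S (\<lambda>x. b j (x \<otimes> a)) (b i)))" for a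
  have rep: "complex_representation G n \<rho>"
    unfolding \<rho>_def using b expand translate by (intro translation_representation) auto
  \<comment> \<open>If \<open>K\<close> acted trivially, \<open>b 0\<close> would be constant on
    each coset of \<open>K\<close>. Its coset sums are 0, so it would vanish on the group, against
    its norm 1.\<close>
  have "\<exists>z\<in>K. \<rho> z \<noteq> 1\<^sub>m n"
  proof (rule ccontr)
    assume "\<not> ?thesis"
    then have triv: "\<rho> z = 1\<^sub>m n" if "z \<in> K" for z using that by blast
    have entry: "ip ?S (\<lambda>x. b 0 (x \<otimes> z)) (b i) = (if i = 0 then 1 else 0)" if "z \<in> K" "i < n" for z i
    proof -
      have "\<rho> z $$ (i, 0) = 1\<^sub>m n $$ (i, 0)" using triv[OF that(1)] by simp
      then show ?thesis using that \<open>n > 0\<close> by (simp add: \<rho>_def split: if_splits)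
    qed
    have inv: "b 0 (x \<otimes> z) = b 0 x" if "x \<in> ?S" "z \<in> K" for x z
    proof -
      have "b 0 (x \<otimes> z) = (\<Sum>i<n. ip ?S (\<lambda>x. b 0 (x \<otimes> z)) (b i) * b i x)"
        using expand[OF translate[OF b(2)[of 0]], of z x] that \<open>n > 0\<close> subset by auto
      also have "\<dots> = (\<Sum>i<n. if i = 0 then b i x else 0)"
        using entry[OF that(2)] by (intro sum.cong) auto
      finally show ?thesis using \<open>n > 0\<close> by simp
    qed
    have "b 0 x = 0" if "x \<in> ?S" for x
    proof -
      have "0 = (\<Sum>z\<in>K. b 0 (x \<otimes> z))"
        using b(2)[OF \<open>n > 0\<close>] that by (simp add: W_def mean_zero_def)
      also have "\<dots> = card K * b 0 x" using that by (simp add: inv)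
      finally show ?thesis using card_K_pos by simp
    qed
    then have "ip ?S (b 0) (b 0) = 0" by (simp add: ip_def)
    with b(1) \<open>n > 0\<close> show False by (simp add: orthonormal_def)
  qed
  with rep qr have "D \<le> real n" unfolding nontrivial_degree_bound_def by blast
  have "l \<ge> 0" using w(3) ip_self_nonneg by metis
  \<comment> \<open>Each \<open>b i\<close> is a unit vector of \<open>W\<close>, so
    \<open>?Q\<close> takes the value \<open>l\<close> on it; the sum is then bounded by the
    Hilbert-Schmidt norm.\<close>
  have "real n * l = (\<Sum>i<n. ?Q (b i))"
  proof -
    have "?Q (b i) = l" if "i < n" for i
      using b(2)[OF that] b(1) that by (simp add: W_def q_def orthonormal_def)
    then show ?thesis by simp
  qed
  also have "\<dots> \<le> card ?S * card X" by (rule sum_ip_conv_le[OF b(1) X])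
  finally have "D * l \<le> card ?S * card X"
    using mult_right_mono[OF \<open>D \<le> real n\<close> \<open>l \<ge> 0\<close>] by linarith
  then have "l \<le> card ?S / D * card X" using D by (simp add: field_simps)
  then have "l * ip ?S u u \<le> card ?S / D * card X * ip ?S u u"
    using ip_self_nonneg by (rule mult_right_mono)
  then show ?thesis using max[OF u] by linarith
qed

end

subsection \<open>Counting representations as products\<close>

lemma finite_listset: "(\<And>X. X \<in> set Xs \<Longrightarrow> finite X) \<Longrightarrow> finite (listset Xs)"
proof (induction Xs)
  case (Cons X Xs)
  have "set_Cons X (listset Xs) = (\<lambda>(x, xs). x # xs) ` (X \<times> listset Xs)"
    by (auto simp: set_Cons_def)
  with Cons show ?case by simp
qed simp

lemma card_listset: "card (listset Xs) = (\<Prod>X\<leftarrow>Xs. card X)"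
proof (induction Xs)
  case (Cons X Xs)
  have "set_Cons X (listset Xs) = (\<lambda>(x, xs). x # xs) ` (X \<times> listset Xs)"
    by (auto simp: set_Cons_def)
  moreover have "inj_on (\<lambda>(x, xs). x # xs) (X \<times> listset Xs)"
    by (auto simp: inj_on_def)
  ultimately show ?case
    using Cons by (simp add: card_image card_cartesian_product)
qed simp

lemma listset_subset_lists:
  "xs \<in> listset Xs \<Longrightarrow> (\<And>X. X \<in> set Xs \<Longrightarrow> X \<subseteq> A) \<Longrightarrow> set xs \<subseteq> A"
  by (induction Xs arbitrary: xs) (auto simp: set_Cons_def, blast+)

lemma listset_nonempty: "(\<And>X. X \<in> set Xs \<Longrightarrow> X \<noteq> {}) \<Longrightarrow> listset Xs \<noteq> {}"
  by (induction Xs) (auto simp: set_Cons_def)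

lemma ordered_prod_Nil [simp]: "ordered_prod G [] = \<one>\<^bsub>G\<^esub>"
  and ordered_prod_Cons [simp]: "ordered_prod G (x # xs) = x \<otimes>\<^bsub>G\<^esub> ordered_prod G xs"
  by (simp_all add: ordered_prod_def)

lemma (in monoid) ordered_prod_closed: "set xs \<subseteq> carrier G \<Longrightarrow> ordered_prod G xs \<in> carrier G"
  by (induction xs) auto

definition rep_count :: "('g, 'm) monoid_scheme \<Rightarrow> 'g set list \<Rightarrow> 'g \<Rightarrow> real" where
  "rep_count G Xs g = real (card {xs \<in> listset Xs. ordered_prod G xs = g})"

text \<open>The orthogonal projection onto functions constant on the left cosets of
  \<open>K\<close>, that is, conditional expectation.\<close>

definition coset_avg :: "('g, 'm) monoid_scheme \<Rightarrow> 'g set \<Rightarrow> ('g \<Rightarrow> real) \<Rightarrow> 'g \<Rightarrow> real" where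
  "coset_avg G K u = (\<lambda>x. (\<Sum>z\<in>K. u (x \<otimes>\<^bsub>G\<^esub> z)) / card K)"

section \<open>Orthogonal splitting by coset averages, and its behaviour under convolution\<close>

context finite_group_with_normal
begin

lemma coset_avg_right_translate:
  assumes "x \<in> carrier G" "z \<in> K"
  shows "coset_avg G K u (x \<otimes> z) = coset_avg G K u x"
proof -
  have z: "z \<in> carrier G" using assms(2) by (rule mem_carrier)
  have cancel: "z \<otimes> (inv z \<otimes> w) = w" "inv z \<otimes> (z \<otimes> w) = w" if "w \<in> carrier G" for w
    using that z by (simp_all flip: m_assoc)
  have "(\<Sum>w\<in>K. u (x \<otimes> z \<otimes> w)) = (\<Sum>w\<in>K. u (x \<otimes> w))"
    using assms z by (intro sum.reindex_bij_witness[of _ "\<lambda>w. inv z \<otimes> w" "\<lambda>w. z \<otimes> w"])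
      (simp_all add: m_assoc cancel)
  then show ?thesis by (simp add: coset_avg_def)
qed

lemma mean_zero_diff_coset_avg: "mean_zero G K (\<lambda>x. u x - coset_avg G K u x)"
  unfolding mean_zero_def
proof
  fix x assume "x \<in> carrier G"
  then have "(\<Sum>z\<in>K. u (x \<otimes> z) - coset_avg G K u (x \<otimes> z)) = (\<Sum>z\<in>K. u (x \<otimes> z)) - card K * coset_avg G K u x"
    by (simp add: sum_subtractf coset_avg_right_translate)
  then show "(\<Sum>z\<in>K. u (x \<otimes> z) - coset_avg G K u (x \<otimes> z)) = 0"
    using card_K_pos by (simp add: coset_avg_def)
qed

text \<open>Translating both arguments by z in \<open>K\<close> keeps the inner product. Summed over
  z, the first factor stays fixed while the second adds up to 0 on each coset.\<close>

lemma ip_coset_avg_mean_zero: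
  assumes "mean_zero G K v"
  shows "ip (carrier G) (coset_avg G K u) v = 0"
proof -
  have "card K * ip (carrier G) (coset_avg G K u) v
      = (\<Sum>z\<in>K. ip (carrier G) (\<lambda>x. coset_avg G K u (x \<otimes> z)) (\<lambda>x. v (x \<otimes> z)))"
    using subset by (simp add: ip_right_translate subset_iff)
  also have "\<dots> = (\<Sum>z\<in>K. ip (carrier G) (coset_avg G K u) (\<lambda>x. v (x \<otimes> z)))"
    by (intro sum.cong ip_cong) (auto simp: coset_avg_right_translate)
  also have "\<dots> = (\<Sum>x\<in>carrier G. coset_avg G K u x * (\<Sum>z\<in>K. v (x \<otimes> z)))"
    unfolding ip_def by (subst sum.swap) (simp add: sum_distrib_left)
  also have "\<dots> = 0" using assms by (simp add: mean_zero_def)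
  finally show ?thesis using card_K_pos by simp
qed

lemma ip_pythagoras:
  fixes u :: "'a \<Rightarrow> real"
  defines "v \<equiv> \<lambda>x. u x - coset_avg G K u x"
  shows "ip (carrier G) u u
    = ip (carrier G) (coset_avg G K u) (coset_avg G K u) + ip (carrier G) v v"
proof -
  let ?p = "coset_avg G K u"
  have u: "u = (\<lambda>x. ?p x + v x)" by (simp add: v_def)
  have pv: "ip (carrier G) ?p v = 0"
    unfolding v_def by (intro ip_coset_avg_mean_zero mean_zero_diff_coset_avg)
  have "ip (carrier G) (\<lambda>x. ?p x + v x) (\<lambda>x. ?p x + v x) = ip (carrier G) ?p ?p + ip (carrier G) v v"
    using pv ip_commute[of "carrier G" v ?p] by (simp add: ip_add_left ip_add_right)
  then show ?thesis using u by simp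
qed

text \<open>Convolution multiplies on the left and averaging on the right, so associativity lets
  them commute.\<close>

lemma coset_avg_conv:
  assumes "X \<subseteq> carrier G" "x \<in> carrier G"
  shows "coset_avg G K (conv G X u) x = conv G X (coset_avg G K u) x"
proof -
  have "(\<Sum>z\<in>K. conv G X u (x \<otimes> z)) = (\<Sum>y\<in>X. \<Sum>z\<in>K. u (inv y \<otimes> (x \<otimes> z)))"
    unfolding conv_def by (rule sum.swap)
  also have "\<dots> = (\<Sum>y\<in>X. \<Sum>z\<in>K. u (inv y \<otimes> x \<otimes> z))"
    using assms subset by (intro sum.cong) (auto simp: m_assoc subset_iff)
  finally show ?thesis by (simp add: coset_avg_def conv_def flip: sum_divide_distrib)
qed

text \<open>Once the first factor \<open>y\<close> is fixed, the others must multiply to y^-1 g.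
  This makes the representation count an iterated convolution.\<close>

lemma rep_count_Cons:
  assumes "X \<subseteq> carrier G" "\<And>Y. Y \<in> set Xs \<Longrightarrow> Y \<subseteq> carrier G" "g \<in> carrier G"
  shows "rep_count G (X # Xs) g = conv G X (rep_count G Xs) g"
proof -
  let ?F = "\<lambda>g. {xs \<in> listset Xs. ordered_prod G xs = g}"
  have fin: "finite X" "finite (listset Xs)"
    by (rule finite_subset[OF assms(1) finite_carrier])
      (rule finite_listset, rule finite_subset[OF assms(2) finite_carrier])
  have "{xs \<in> listset (X # Xs). ordered_prod G xs = g}
      = (\<lambda>(y, ys). y # ys) ` (SIGMA y:X. ?F (inv y \<otimes> g))"
  proof -
    have *: "y \<otimes> ordered_prod G ys = g \<longleftrightarrow> ordered_prod G ys = inv y \<otimes> g"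
      if "y \<in> X" "ys \<in> listset Xs" for y ys
    proof -
      have p: "ordered_prod G ys \<in> carrier G"
        by (rule ordered_prod_closed) (rule listset_subset_lists[OF that(2) assms(2)])
      from inv_solve_left[OF p _ assms(3), of y] show ?thesis using that(1) assms(1) by auto
    qed
    have "{xs \<in> listset (X # Xs). ordered_prod G xs = g}
        = (\<lambda>(y, ys). y # ys) ` (SIGMA y:X. {ys \<in> listset Xs. y \<otimes> ordered_prod G ys = g})"
      by (auto simp: set_Cons_def image_iff)
    also have "(SIGMA y:X. {ys \<in> listset Xs. y \<otimes> ordered_prod G ys = g}) = (SIGMA y:X. ?F (inv y \<otimes> g))"
      by (intro Sigma_cong Collect_cong conj_cong refl *)
    finally show ?thesis .
  qed
  moreover have "inj_on (\<lambda>(y, ys). y # ys) (SIGMA y:X. ?F (inv y \<otimes> g))"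
    by (auto simp: inj_on_def)
  ultimately have "card {xs \<in> listset (X # Xs). ordered_prod G xs = g} = (\<Sum>y\<in>X. card (?F (inv y \<otimes> g)))"
    using fin by (simp add: card_image)
  then show ?thesis by (simp add: rep_count_def conv_def)
qed

lemma rep_count_singleton: "rep_count G [X] g = of_bool (g \<in> X)" if "X \<subseteq> carrier G"
proof -
  have "{xs \<in> listset [X]. ordered_prod G xs = g} = (if g \<in> X then {[g]} else {})"
    using that by (auto simp: set_Cons_def subset_iff)
  then show ?thesis by (simp add: rep_count_def)
qed

text \<open>Since \<open>conv G X\<close> commutes with averaging, it carries the deviation for
  \<open>Xs\<close> to that for \<open>X # Xs\<close>, and each such step costs |G|/D |X|. The last
  set costs only |X|, the squared norm of its indicator; hence the exponent
  \<open>length Xs - 1\<close>.\<close>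

lemma rep_count_deviation_le:
  assumes D: "D > 0" and qr: "nontrivial_degree_bound G K D"
    and Xs: "Xs \<noteq> []" "\<And>X. X \<in> set Xs \<Longrightarrow> X \<subseteq> carrier G"
  defines "v \<equiv> \<lambda>Xs x. rep_count G Xs x - coset_avg G K (rep_count G Xs) x"
  shows "ip (carrier G) (v Xs) (v Xs)
    \<le> (card (carrier G) / D) ^ (length Xs - 1) * (\<Prod>X\<leftarrow>Xs. real (card X))"
  using Xs
proof (induction Xs rule: list_nonempty_induct)
  case (single X)
  then have X: "X \<subseteq> carrier G" by simp
  have "ip (carrier G) (v [X]) (v [X]) \<le> ip (carrier G) (rep_count G [X]) (rep_count G [X])"
    unfolding v_def using ip_pythagoras[of "rep_count G [X]"] ip_self_nonneg by simp
  also have "\<dots> = (\<Sum>x\<in>carrier G. if x \<in> X then 1 else 0)"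
    unfolding ip_def using X by (intro sum.cong) (auto simp: rep_count_singleton)
  also have "\<dots> = card X"
    using finite_carrier X by (simp add: sum.inter_restrict[symmetric] Int_absorb1)
  finally show ?case by simp
next
  case (cons X Xs)
  then have X: "X \<subseteq> carrier G" and Xs: "\<And>Y. Y \<in> set Xs \<Longrightarrow> Y \<subseteq> carrier G" by auto
  let ?c = "card (carrier G) / D"
  have "v (X # Xs) x = conv G X (v Xs) x" if x: "x \<in> carrier G" for x
  proof -
    have "(\<Sum>z\<in>K. rep_count G (X # Xs) (x \<otimes> z)) = (\<Sum>z\<in>K. conv G X (rep_count G Xs) (x \<otimes> z))"
      using rep_count_Cons[OF X Xs] x subset by (intro sum.cong) auto
    then have "coset_avg G K (rep_count G (X # Xs)) x = coset_avg G K (conv G X (rep_count G Xs)) x"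
      by (simp add: coset_avg_def)
    then show ?thesis
      unfolding v_def using rep_count_Cons[OF X Xs x] coset_avg_conv[OF X x]
        conv_lincomb[of X "rep_count G Xs" "-1" "coset_avg G K (rep_count G Xs)"]
      by (simp add: fun_eq_iff)
  qed
  then have "ip (carrier G) (v (X # Xs)) (v (X # Xs)) = ip (carrier G) (conv G X (v Xs)) (conv G X (v Xs))"
    by (intro ip_cong)
  also have "\<dots> \<le> ?c * card X * ip (carrier G) (v Xs) (v Xs)"
    unfolding v_def by (intro conv_norm_le D qr X mean_zero_diff_coset_avg)
  also have "\<dots> \<le> ?c * card X * (?c ^ (length Xs - 1) * (\<Prod>X\<leftarrow>Xs. real (card X)))"
    using D by (intro mult_left_mono cons.IH Xs) auto
  \<comment> \<open>The truncated \<open>length Xs - 1\<close> grows by one here because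
    \<open>Xs\<close> is nonempty.\<close>
  also have "\<dots> = ?c ^ (length (X # Xs) - 1) * (\<Prod>X\<leftarrow>X # Xs. real (card X))"
    using cons.hyps by (cases Xs) (simp_all add: algebra_simps)
  finally show ?case .
qed

text \<open>Cauchy-Schwarz on the product set, over which the representation counts sum to the
  number of tuples.\<close>

lemma card_product_set_ge:
  assumes "\<And>X. X \<in> set Xs \<Longrightarrow> X \<subseteq> carrier G"
  shows "(\<Prod>X\<leftarrow>Xs. real (card X))\<^sup>2
    \<le> card (product_set G Xs) * ip (carrier G) (rep_count G Xs) (rep_count G Xs)"
proof -
  let ?P = "product_set G Xs"
  have fin: "finite (listset Xs)"
    by (rule finite_listset) (rule finite_subset[OF assms finite_carrier])
  have sub: "?P \<subseteq> carrier G"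
    unfolding product_set_def by (intro image_subsetI ordered_prod_closed listset_subset_lists[OF _ assms])
  have "(\<Prod>X\<leftarrow>Xs. real (card X)) = real (card (listset Xs))"
    unfolding card_listset by (induction Xs) auto
  also have "\<dots> = (\<Sum>g\<in>?P. rep_count G Xs g)"
    unfolding product_set_def rep_count_def card_eq_sum[of "listset Xs"]
    using sum.image_gen[OF fin, of "\<lambda>_. 1::nat" "ordered_prod G"] by simp
  finally have "(\<Prod>X\<leftarrow>Xs. real (card X))\<^sup>2 \<le> card ?P * (\<Sum>g\<in>?P. (rep_count G Xs g)\<^sup>2)"
    using sum_squared_le_sum_of_squares[of "rep_count G Xs" ?P] by (simp add: mult.commute)
  also have "\<dots> \<le> card ?P * ip (carrier G) (rep_count G Xs) (rep_count G Xs)"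
    unfolding ip_def power2_eq_square using sub finite_carrier
    by (intro mult_left_mono sum_mono2) auto
  finally show ?thesis .
qed

end

subsection \<open>Semidirect products\<close>

locale semidirect = N: group N + H: group H
  for N :: "('a, 'm) monoid_scheme" (structure) and H :: "('b, 'n) monoid_scheme" (structure) +
  fixes \<phi> :: "'b \<Rightarrow> 'a \<Rightarrow> 'a"
  assumes action: "\<phi> \<in> hom H (AutoGroup N)"
begin

abbreviation G :: "('a \<times> 'b) monoid" where "G \<equiv> semidirect_product N H \<phi>"

lemma carrier_G: "carrier G = carrier N \<times> carrier H"
  and mult_G: "(z1, h1) \<otimes>\<^bsub>G\<^esub> (z2, h2) = (z1 \<otimes>\<^bsub>N\<^esub> \<phi> h1 z2, h1 \<otimes>\<^bsub>H\<^esub> h2)"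
  and one_G: "\<one>\<^bsub>G\<^esub> = (\<one>\<^bsub>N\<^esub>, \<one>\<^bsub>H\<^esub>)"
  by (simp_all add: semidirect_product_def)

lemma action_auto:
  assumes "h \<in> carrier H"
  shows "\<phi> h \<in> hom N N" "bij_betw (\<phi> h) (carrier N) (carrier N)"
  using hom_in_carrier[OF action assms] by (auto simp: AutoGroup_def auto_def Bij_def)

lemma action_closed: "h \<in> carrier H \<Longrightarrow> z \<in> carrier N \<Longrightarrow> \<phi> h z \<in> carrier N"
  using action_auto(1) hom_in_carrier by metis

lemma action_mult:
  "h \<in> carrier H \<Longrightarrow> z \<in> carrier N \<Longrightarrow> w \<in> carrier N \<Longrightarrow> \<phi> h (z \<otimes>\<^bsub>N\<^esub> w) = \<phi> h z \<otimes>\<^bsub>N\<^esub> \<phi> h w"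
  using action_auto(1) by (simp add: hom_mult)

lemma action_one: "h \<in> carrier H \<Longrightarrow> \<phi> h \<one>\<^bsub>N\<^esub> = \<one>\<^bsub>N\<^esub>"
  using action_auto(1) hom_one N.is_group by metis

lemma action_comp:
  assumes "h \<in> carrier H" "h' \<in> carrier H" "z \<in> carrier N"
  shows "\<phi> (h \<otimes>\<^bsub>H\<^esub> h') z = \<phi> h (\<phi> h' z)"
proof -
  \<comment> \<open>Multiplication in \<open>BijGroup\<close> is restricted to bijections, so both
    memberships are needed to unfold it to composition.\<close>
  have "\<phi> h \<in> Bij (carrier N)" "\<phi> h' \<in> Bij (carrier N)"
    using hom_in_carrier[OF action] assms by (auto simp: AutoGroup_def auto_def)
  moreover have "\<phi> (h \<otimes>\<^bsub>H\<^esub> h') = \<phi> h \<otimes>\<^bsub>AutoGroup N\<^esub> \<phi> h'"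
    using action assms by (simp add: hom_mult)
  ultimately show ?thesis
    using assms by (simp add: AutoGroup_def BijGroup_def compose_def)
qed

lemma action_id:
  assumes "z \<in> carrier N"
  shows "\<phi> \<one>\<^bsub>H\<^esub> z = z"
proof -
  have "\<phi> \<one>\<^bsub>H\<^esub> (\<phi> \<one>\<^bsub>H\<^esub> z) = \<phi> \<one>\<^bsub>H\<^esub> z"
    using action_comp[of "\<one>\<^bsub>H\<^esub>" "\<one>\<^bsub>H\<^esub>" z] assms by simp
  moreover have "inj_on (\<phi> \<one>\<^bsub>H\<^esub>) (carrier N)"
    using action_auto(2) by (auto simp: bij_betw_def)
  ultimately show ?thesis
    using assms action_closed by (simp add: inj_on_eq_iff)
qed

lemma group_G: "group G"
proof (rule groupI)
  fix x y assume "x \<in> carrier G" "y \<in> carrier G"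
  then show "x \<otimes>\<^bsub>G\<^esub> y \<in> carrier G"
    by (cases x; cases y) (simp add: carrier_G mult_G action_closed)
next
  fix x y z assume "x \<in> carrier G" "y \<in> carrier G" "z \<in> carrier G"
  then show "x \<otimes>\<^bsub>G\<^esub> y \<otimes>\<^bsub>G\<^esub> z = x \<otimes>\<^bsub>G\<^esub> (y \<otimes>\<^bsub>G\<^esub> z)"
    by (cases x; cases y; cases z)
       (simp add: carrier_G mult_G action_closed action_comp action_mult N.m_assoc H.m_assoc)
next
  fix x assume x: "x \<in> carrier G"
  then show "\<one>\<^bsub>G\<^esub> \<otimes>\<^bsub>G\<^esub> x = x"
    by (cases x) (simp add: carrier_G mult_G one_G action_id)
  obtain z h where zh: "x = (z, h)" "z \<in> carrier N" "h \<in> carrier H"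
    using x by (cases x) (auto simp: carrier_G)
  \<comment> \<open>The first coordinate is the image of z^-1 z under the automorphism for h^-1,
    hence 1.\<close>
  then have "(\<phi> (inv\<^bsub>H\<^esub> h) (inv\<^bsub>N\<^esub> z), inv\<^bsub>H\<^esub> h) \<otimes>\<^bsub>G\<^esub> x = \<one>\<^bsub>G\<^esub>"
    by (simp add: mult_G one_G action_one flip: action_mult)
  then show "\<exists>y\<in>carrier G. y \<otimes>\<^bsub>G\<^esub> x = \<one>\<^bsub>G\<^esub>"
    using zh by (intro bexI) (auto simp: carrier_G action_closed)
qed (simp add: carrier_G one_G)

lemma normal_N: "carrier N \<times> {\<one>\<^bsub>H\<^esub>} \<lhd> G"
proof -
  have "group_hom G H snd"
    by (intro group_hom.intro group_hom_axioms.intro group_G H.is_group homI)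
       (auto simp: carrier_G mult_G)
  then have "kernel G H snd \<lhd> G" by (rule group_hom.normal_kernel)
  moreover have "kernel G H snd = carrier N \<times> {\<one>\<^bsub>H\<^esub>}"
    by (auto simp: kernel_def carrier_G)
  ultimately show ?thesis by simp
qed

lemma snd_ordered_prod: "snd (ordered_prod G xs) = ordered_prod H (map snd xs)"
proof (induction xs)
  case (Cons x xs)
  then show ?case by (cases x; cases "ordered_prod G xs") (simp add: mult_G)
qed (simp add: one_G)

text \<open>On the coset lying over \<open>h\<close> the average is |L h| / |N|, where
  \<open>L h\<close> is the set of tuples whose \<open>H\<close>-product is \<open>h\<close>.
  Squaring and summing over \<open>N\<close> and \<open>H\<close> leaves the sum of |L h|^2 / |N|,
  and the numerators count the colliding pairs according to their common
  \<open>H\<close>-product.\<close>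

lemma ip_coset_avg_rep_count:
  assumes finN: "finite (carrier N)" and finH: "finite (carrier H)"
    and Xs: "\<And>X. X \<in> set Xs \<Longrightarrow> X \<subseteq> carrier G"
  defines "p \<equiv> coset_avg G (carrier N \<times> {\<one>\<^bsub>H\<^esub>}) (rep_count G Xs)"
  shows "ip (carrier G) p p = dot_count H Xs / card (carrier N)"
proof -
  define L where "L h = {xs \<in> listset Xs. ordered_prod H (map snd xs) = h}" for h
  have fin: "finite (listset Xs)"
    using finN finH by (intro finite_listset) (rule finite_subset[OF Xs], simp_all add: carrier_G)
  have closed: "ordered_prod G xs \<in> carrier G" if "xs \<in> listset Xs" for xs
    using group.is_monoid[OF group_G] listset_subset_lists[OF that Xs] by (simp add: monoid.ordered_prod_closed)
  have fibre: "(\<Sum>z\<in>carrier N. rep_count G Xs (z, h)) = card (L h)" for h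
  proof -
    have "L h = (\<Union>z\<in>carrier N. {xs \<in> listset Xs. ordered_prod G xs = (z, h)})"
    proof -
      have "\<exists>z\<in>carrier N. ordered_prod G xs = (z, snd (ordered_prod G xs))" if "xs \<in> listset Xs" for xs
        using closed[OF that] by (cases "ordered_prod G xs") (simp add: carrier_G)
      then show ?thesis by (auto simp: L_def simp flip: snd_ordered_prod)
    qed
    then have "card (L h) = (\<Sum>z\<in>carrier N. card {xs \<in> listset Xs. ordered_prod G xs = (z, h)})"
      using fin finN by (simp only:) (subst card_UN_disjoint, auto)
    then show ?thesis by (simp add: rep_count_def)
  qed
  have p: "p (z, h) = card (L h) / card (carrier N)" if "z \<in> carrier N" "h \<in> carrier H" for z h
  proof -
    \<comment> \<open>This map gives the first coordinate of (z, h)(w, 1); being a permutation of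
      \<open>N\<close>, it turns the coset sum into the fibre sum.\<close>
    have bij: "bij_betw (\<lambda>w. z \<otimes>\<^bsub>N\<^esub> \<phi> h w) (carrier N) (carrier N)"
    proof -
      have "bij_betw (\<lambda>w. z \<otimes>\<^bsub>N\<^esub> w) (carrier N) (carrier N)"
        using that by (intro bij_betw_byWitness[of _ "\<lambda>w. inv\<^bsub>N\<^esub> z \<otimes>\<^bsub>N\<^esub> w"]) (auto simp flip: N.m_assoc)
      from bij_betw_trans[OF action_auto(2)[OF that(2)] this] show ?thesis by (simp add: comp_def)
    qed
    have "(\<Sum>x\<in>carrier N \<times> {\<one>\<^bsub>H\<^esub>}. rep_count G Xs ((z, h) \<otimes>\<^bsub>G\<^esub> x))
        = (\<Sum>w\<in>carrier N. rep_count G Xs (z \<otimes>\<^bsub>N\<^esub> \<phi> h w, h))"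
      using that by (intro sum.reindex_bij_witness[of _ "\<lambda>w. (w, \<one>\<^bsub>H\<^esub>)" fst]) (auto simp: mult_G)
    also have "\<dots> = (\<Sum>w\<in>carrier N. rep_count G Xs (w, h))"
      using sum.reindex_bij_betw[OF bij, of "\<lambda>w. rep_count G Xs (w, h)"] .
    finally show ?thesis by (simp add: p_def coset_avg_def fibre card_cartesian_product)
  qed
  have "dot_count H Xs = card (\<Union>h\<in>carrier H. L h \<times> L h)"
  proof -
    have "ordered_prod H (map snd xs) \<in> carrier H" if "xs \<in> listset Xs" for xs
      using closed[OF that] by (auto simp: carrier_G simp flip: snd_ordered_prod)
    then have "{(xs, ys). xs \<in> listset Xs \<and> ys \<in> listset Xs \<and>
        ordered_prod H (map snd xs) = ordered_prod H (map snd ys)} = (\<Union>h\<in>carrier H. L h \<times> L h)"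
      by (auto simp: L_def)
    then show ?thesis by (simp add: dot_count_def)
  qed
  also have "\<dots> = (\<Sum>h\<in>carrier H. card (L h \<times> L h))"
    using fin finH by (intro card_UN_disjoint) (auto simp: L_def)
  finally have dot: "dot_count H Xs = (\<Sum>h\<in>carrier H. card (L h) * card (L h))"
    by (simp add: card_cartesian_product)
  have "ip (carrier G) p p = (\<Sum>h\<in>carrier H. \<Sum>z\<in>carrier N. p (z, h) * p (z, h))"
    unfolding ip_def carrier_G by (subst sum.swap) (simp add: sum.cartesian_product split_def)
  also have "\<dots> = (\<Sum>h\<in>carrier H. \<Sum>z\<in>carrier N. (real (card (L h)) / card (carrier N)) * (card (L h) / card (carrier N)))"
    using p by (intro sum.cong) auto
  also have "\<dots> = (\<Sum>h\<in>carrier H. real (card (L h)) * card (L h) / card (carrier N))"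
    using finN by (intro sum.cong) auto
  also have "\<dots> = dot_count H Xs / card (carrier N)"
    by (simp add: dot sum_divide_distrib)
  finally show ?thesis .
qed

lemma nontrivial_degree_bound_iff:
  "nontrivial_degree_bound G (carrier N \<times> {\<one>\<^bsub>H\<^esub>}) D \<longleftrightarrow> quasirandom_on_normal N H \<phi> D"
  by (simp add: nontrivial_degree_bound_def quasirandom_on_normal_def type_II_def)

end

section \<open>Combining the two bounds\<close>

lemma half_min_le:
  fixes P :: real
  assumes "P > 0" "a > 0" "b > 0" "P \<le> c * (a + b)"
  shows "c \<ge> 1 / 2 * min (P / a) (P / b)"
proof -
  \<comment> \<open>The mean of \<open>a\<close> and \<open>b\<close> is at most the larger one,
    which is the denominator of the smaller quotient. This is the source of the factor 1/2.\<close>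
  have "min (P / a) (P / b) \<le> P / ((a + b) / 2)"
  proof (cases "a \<le> b")
    case True
    then have "P / b \<le> P / ((a + b) / 2)" using assms by (intro divide_left_mono) auto
    then show ?thesis by (rule min.coboundedI2)
  next
    case False
    then have "P / a \<le> P / ((a + b) / 2)" using assms by (intro divide_left_mono) auto
    then show ?thesis by (rule min.coboundedI1)
  qed
  also have "\<dots> \<le> 2 * c" using assms by (simp add: field_simps)
  finally show ?thesis by simp
qed

theorem theorem4:
  fixes N :: "('a, 'm) monoid_scheme" and H :: "('b, 'n) monoid_scheme"
    and \<phi> :: "'b \<Rightarrow> 'a \<Rightarrow> 'a" and G :: "('a \<times> 'b) monoid"
    and D :: real and k :: nat and Xs :: "('a \<times> 'b) set list"
  assumes "group N" and "finite (carrier N)"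
    and "group H" and "finite (carrier H)"
    and "\<phi> \<in> hom H (AutoGroup N)"
    and "G = semidirect_product N H \<phi>"
    and "D > 0" and "quasirandom_on_normal N H \<phi> D"
    and "k \<ge> 2" and "length Xs = k"
    and "\<And>X. X \<in> set Xs \<Longrightarrow> X \<noteq> {} \<and> X \<subseteq> carrier G"
  shows "real (card (product_set G Xs)) \<ge>
    1 / 2 * min
      (real (card (carrier N)) / real (dot_count H Xs) * (\<Prod>X\<leftarrow>Xs. (real (card X))\<^sup>2))
      (D ^ (k - 1) / real (card (carrier G)) ^ (k - 1) * (\<Prod>X\<leftarrow>Xs. real (card X)))"
proof -
  interpret S: semidirect N H \<phi>
    using assms(1,3,5) by (intro semidirect.intro semidirect_axioms.intro)
  note G = \<open>G = semidirect_product N H \<phi>\<close>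
  let ?K = "carrier N \<times> {\<one>\<^bsub>H\<^esub>}"
  have finG: "finite (carrier G)" using assms(2,4) by (simp add: G S.carrier_G)
  interpret finite_group_with_normal ?K G
    using S.normal_N finG unfolding G
    by (intro finite_group_with_normal.intro finite_group_with_normal_axioms.intro)
  have Xs: "X \<subseteq> carrier G" "X \<noteq> {}" "finite X" if "X \<in> set Xs" for X
    using assms(11)[OF that] finG finite_subset by auto
  define P where "P = (\<Prod>X\<leftarrow>Xs. real (card X))"
  \<comment> \<open>\<open>a\<close> is the squared norm of the coset average of the representation
    count and \<open>b\<close> bounds that of the deviation; P^2/a and P^2/b are the two terms of
    the minimum.\<close>
  define a where "a = real (dot_count H Xs) / card (carrier N)"
  define b where "b = (card (carrier G) / D) ^ (k - 1) * P"
  have cN: "card (carrier N) > 0"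
    using assms(2) S.N.one_closed by (auto simp: card_gt_0_iff)
  have cG: "card (carrier G) > 0"
    using finG one_closed by (auto simp: card_gt_0_iff)
  have "card X > 0" if "X \<in> set Xs" for X
    using Xs(2,3)[OF that] by (simp add: card_gt_0_iff)
  then have "P > 0"
    unfolding P_def by (induction Xs) auto
  \<comment> \<open>Any tuple collides with itself.\<close>
  have "dot_count H Xs > 0"
  proof -
    obtain xs where "xs \<in> listset Xs" using listset_nonempty[of Xs] Xs(2) by blast
    moreover have "finite {(xs, ys). xs \<in> listset Xs \<and> ys \<in> listset Xs \<and>
      ordered_prod H (map snd xs) = ordered_prod H (map snd ys)}"
      by (rule finite_subset[of _ "listset Xs \<times> listset Xs"]) (auto intro: finite_listset Xs(3))
    ultimately show ?thesis unfolding dot_count_def by (auto simp: card_gt_0_iff)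
  qed
  then have "a > 0" using cN by (simp add: a_def)
  have "b > 0" using cG \<open>P > 0\<close> assms(7) by (simp add: b_def)
  have "ip (carrier G) (rep_count G Xs) (rep_count G Xs) \<le> a + b"
    unfolding ip_pythagoras[of "rep_count G Xs"]
  proof (rule add_mono)
    show "ip (carrier G) (coset_avg G ?K (rep_count G Xs)) (coset_avg G ?K (rep_count G Xs)) \<le> a"
      using S.ip_coset_avg_rep_count[OF assms(2,4), of Xs] Xs(1) by (simp add: G a_def)
    have "nontrivial_degree_bound G ?K D"
      using assms(8) S.nontrivial_degree_bound_iff by (simp add: G)
    moreover have "Xs \<noteq> []" using assms(9,10) by auto
    ultimately show "ip (carrier G)
        (\<lambda>x. rep_count G Xs x - coset_avg G ?K (rep_count G Xs) x)
        (\<lambda>x. rep_count G Xs x - coset_avg G ?K (rep_count G Xs) x) \<le> b"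
      using rep_count_deviation_le[OF assms(7), of Xs] Xs(1) assms(10) by (simp add: b_def P_def)
  qed
  then have "P\<^sup>2 \<le> card (product_set G Xs) * (a + b)"
    unfolding P_def by (intro order_trans[OF card_product_set_ge[OF Xs(1)]] mult_left_mono) simp_all
  then have "card (product_set G Xs) \<ge> 1 / 2 * min (P\<^sup>2 / a) (P\<^sup>2 / b)"
    using \<open>P > 0\<close> \<open>a > 0\<close> \<open>b > 0\<close> by (intro half_min_le) auto
  moreover have "P\<^sup>2 / a = real (card (carrier N)) / real (dot_count H Xs) * (\<Prod>X\<leftarrow>Xs. (real (card X))\<^sup>2)"
  proof -
    have "P\<^sup>2 = (\<Prod>X\<leftarrow>Xs. (real (card X))\<^sup>2)"
      unfolding P_def by (induction Xs) (auto simp: power_mult_distrib)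
    then show ?thesis by (simp add: a_def)
  qed
  moreover have "P\<^sup>2 / b = D ^ (k - 1) / real (card (carrier G)) ^ (k - 1) * P"
    using \<open>P > 0\<close> unfolding b_def power_divide power2_eq_square by simp
  ultimately show ?thesis by (simp add: P_def)
qed

end
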